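(* Let $Q$ be a compact Hausdorff space, let $n$ be an arbitrary infinite cardinal number, and let $C(Q, M_n(\mathbb{C}))$ be the algebra of all continuous maps from $Q$ to $M_n(\mathbb{C})$. Let $\bigtriangleup : C(Q, M_n(\mathbb{C})) \to C(Q, M_n(\mathbb{C}))$ be a 2-local derivation (not assumed linear). Then $\bigtriangleup$ is a derivation.
   Context: Let $\Xi$ be an index set of cardinality $n$ (an infinite cardinal). For $i,j\in\Xi$ let $e_{ij}$ be the $\Xi\times\Xi$ matrix with $1$ in position $(i,j)$ and $0$ elsewhere. $M_n(\mathbb{C})$ is the set of all matrices $\{\lambda^{ij}e_{ij}\}_{i,j\in\Xi}$ with $\lambda^{ij}\in\mathbb{C}$ for which there is a number $K\in\mathbb{R}$ such that every finite square submatrix (indexed by a finite subset of $\Xi$) has operator norm at most $K$. With entrywise linear operations, the usual matrix product $\{\lambda^{ij}e_{ij}\}\{\mu^{ij}e_{ij}\}=\{\sum_{\xi\in\Xi}\lambda^{i\xi}\mu^{\xi j}e_{ij}\}$, and the norm equal to the supremum of the operator norms of the finite square submatrices, $M_n(\mathbb{C})$ is identified with the algebra $B(l_2(\Xi))$ of all bounded linear operators on the complex Hilbert space $l_2(\Xi)$. Continuity of maps $Q\to M_n(\mathbb{C})$ is with respect to the norm, and $C(Q,M_n(\mathbb{C}))$ has pointwise operations. A derivation on an associative algebra $A$ is a linear map $D:A\to A$ with $D(xy)=D(x)y+xD(y)$ for all $x,y\in A$. A 2-local derivation on $A$ is a map $\bigtriangleup:A\to A$ (not linear in general) such that for every two elements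 $x,y\in A$ there exists a derivation $D_{x,y}:A\to A$ with $\bigtriangleup(x)=D_{x,y}(x)$ and $\bigtriangleup(y)=D_{x,y}(y)$. *)

theory Defs
  imports "HOL-Analysis.Analysis" "HOL-Library.Function_Algebras"
begin

section \<open>Finite square submatrices\<close>

definition submat_apply :: "'i set \<Rightarrow> ('i \<Rightarrow> 'i \<Rightarrow> complex) \<Rightarrow> ('i \<Rightarrow> complex) \<Rightarrow> 'i \<Rightarrow> complex"
  where "submat_apply F a x i = (\<Sum>j\<in>F. a i j * x j)"

text \<open>
  Operator norm, on the complex Hilbert space of functions on \<open>F\<close>, of the submatrix of \<open>a\<close>
  with rows and columns in the finite set \<open>F\<close>.
\<close>

definition submat_norm :: "'i set \<Rightarrow> ('i \<Rightarrow> 'i \<Rightarrow> complex) \<Rightarrow> real"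
  where "submat_norm F a =
    (SUP x\<in>{x. L2_set (\<lambda>j. cmod (x j)) F \<le> 1}. L2_set (\<lambda>i. cmod (submat_apply F a x i)) F)"

definition bounded_matrix :: "('i \<Rightarrow> 'i \<Rightarrow> complex) \<Rightarrow> bool"
  where "bounded_matrix a \<longleftrightarrow> (\<exists>K. \<forall>F. finite F \<longrightarrow> submat_norm F a \<le> K)"

definition matrix_norm :: "('i \<Rightarrow> 'i \<Rightarrow> complex) \<Rightarrow> real"
  where "matrix_norm a = (SUP F\<in>{F. finite F}. submat_norm F a)"

definition matrix_prod ::
    "('i \<Rightarrow> 'i \<Rightarrow> complex) \<Rightarrow> ('i \<Rightarrow> 'i \<Rightarrow> complex) \<Rightarrow> 'i \<Rightarrow> 'i \<Rightarrow> complex"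
  where "matrix_prod a b i j = (\<Sum>\<^sub>\<infinity>\<xi>. a i \<xi> * b \<xi> j)"

lemma submat_norm_bdd:
  assumes "finite F"
  shows "bdd_above ((\<lambda>x. L2_set (\<lambda>i. cmod (submat_apply F a x i)) F) `
           {x. L2_set (\<lambda>j. cmod (x j)) F \<le> 1})"
proof (rule bdd_aboveI2)
  fix x :: "'a \<Rightarrow> complex" assume "x \<in> {x. L2_set (\<lambda>j. cmod (x j)) F \<le> 1}"
  then have x: "cmod (x j) \<le> 1" if "j \<in> F" for j
    using member_le_L2_set[OF assms that, of "\<lambda>j. cmod (x j)"] by simp
  have "L2_set (\<lambda>i. cmod (submat_apply F a x i)) F \<le> (\<Sum>i\<in>F. cmod (submat_apply F a x i))"
    by (rule L2_set_le_sum) simp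
  also have "\<dots> \<le> (\<Sum>i\<in>F. \<Sum>j\<in>F. cmod (a i j))"
    unfolding submat_apply_def
    by (intro sum_mono order_trans[OF norm_sum])
       (simp add: norm_mult mult_left_le x)
  finally show "L2_set (\<lambda>i. cmod (submat_apply F a x i)) F \<le> (\<Sum>i\<in>F. \<Sum>j\<in>F. cmod (a i j))" .
qed

lemma submat_norm_nonneg: "finite F \<Longrightarrow> 0 \<le> submat_norm F a"
  unfolding submat_norm_def
  by (rule cSUP_upper2[OF submat_norm_bdd, where x = "\<lambda>_. 0"]) (auto simp: L2_set_0')

lemma submat_apply_scale: "submat_apply F a (\<lambda>j. c * x j) i = c * submat_apply F a x i"
  by (simp add: submat_apply_def sum_distrib_left mult_ac)

lemma L2_set_cmod_scale:
  "L2_set (\<lambda>j. cmod (c * f j)) F = cmod c * L2_set (\<lambda>j. cmod (f j)) F"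
  by (simp add: norm_mult L2_set_right_distrib)

lemma submat_norm_bound:
  assumes "finite F"
  shows "L2_set (\<lambda>i. cmod (submat_apply F a x i)) F \<le> submat_norm F a * L2_set (\<lambda>j. cmod (x j)) F"
proof (cases "L2_set (\<lambda>j. cmod (x j)) F = 0")
  case True
  then have "x j = 0" if "j \<in> F" for j
    using assms that by (simp add: L2_set_eq_0_iff)
  then show ?thesis
    by (simp add: True submat_apply_def L2_set_0')
next
  case False
  define r where "r = L2_set (\<lambda>j. cmod (x j)) F"
  have r: "r > 0"
    using False by (simp add: r_def less_le)
  define c where "c = complex_of_real (inverse r)"
  have c: "cmod c = inverse r"
    using r by (simp add: c_def norm_inverse)
  have "L2_set (\<lambda>i. cmod (submat_apply F a (\<lambda>j. c * x j) i)) F \<le> submat_norm F a"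
    unfolding submat_norm_def
  proof (rule cSUP_upper[OF _ submat_norm_bdd[OF assms]])
    show "(\<lambda>j. c * x j) \<in> {x. L2_set (\<lambda>j. cmod (x j)) F \<le> 1}"
      using r by (simp only: mem_Collect_eq L2_set_cmod_scale c flip: r_def) simp
  qed
  then have "inverse r * L2_set (\<lambda>i. cmod (submat_apply F a x i)) F \<le> submat_norm F a"
    by (simp only: submat_apply_scale L2_set_cmod_scale c)
  then show ?thesis
    using r by (simp add: field_simps flip: r_def)
qed

lemma submat_norm_leI:
  assumes "0 \<le> K"
    and "\<And>x. L2_set (\<lambda>i. cmod (submat_apply F a x i)) F \<le> K * L2_set (\<lambda>j. cmod (x j)) F"
  shows "submat_norm F a \<le> K"
  unfolding submat_norm_def
proof (rule cSUP_least)
  show "{x. L2_set (\<lambda>j. cmod (x j)) F \<le> 1} \<noteq> {}"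
    by (auto intro!: exI[of _ "\<lambda>_. 0"] simp: L2_set_0')
  fix x assume "x \<in> {x. L2_set (\<lambda>j. cmod (x j)) F \<le> 1}"
  then show "L2_set (\<lambda>i. cmod (submat_apply F a x i)) F \<le> K"
    using assms(2)[of x] mult_left_le[of "L2_set (\<lambda>j. cmod (x j)) F" K] assms(1) by auto
qed

lemma submat_norm_add_le:
  assumes "finite F"
  shows "submat_norm F (\<lambda>i j. a i j + b i j) \<le> submat_norm F a + submat_norm F b"
proof (rule submat_norm_leI)
  fix x :: "'a \<Rightarrow> complex"
  have "L2_set (\<lambda>i. cmod (submat_apply F (\<lambda>i j. a i j + b i j) x i)) F
      \<le> L2_set (\<lambda>i. cmod (submat_apply F a x i) + cmod (submat_apply F b x i)) F"
    by (intro L2_set_mono)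
       (auto simp: submat_apply_def distrib_right sum.distrib norm_triangle_ineq)
  also have "\<dots> \<le> L2_set (\<lambda>i. cmod (submat_apply F a x i)) F + L2_set (\<lambda>i. cmod (submat_apply F b x i)) F"
    by (rule L2_set_triangle_ineq)
  also have "\<dots> \<le> (submat_norm F a + submat_norm F b) * L2_set (\<lambda>j. cmod (x j)) F"
    using submat_norm_bound[OF assms, of a x] submat_norm_bound[OF assms, of b x]
    by (simp add: distrib_right)
  finally show "L2_set (\<lambda>i. cmod (submat_apply F (\<lambda>i j. a i j + b i j) x i)) F
      \<le> (submat_norm F a + submat_norm F b) * L2_set (\<lambda>j. cmod (x j)) F" .
qed (simp add: submat_norm_nonneg assms)

lemma submat_norm_scale_le:
  assumes "finite F"
  shows "submat_norm F (\<lambda>i j. c * a i j) \<le> cmod c * submat_norm F a"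
proof (rule submat_norm_leI)
  fix x :: "'a \<Rightarrow> complex"
  have "submat_apply F (\<lambda>i j. c * a i j) x = (\<lambda>i. c * submat_apply F a x i)"
    by (rule ext) (simp add: submat_apply_def sum_distrib_left mult_ac)
  then show "L2_set (\<lambda>i. cmod (submat_apply F (\<lambda>i j. c * a i j) x i)) F
      \<le> cmod c * submat_norm F a * L2_set (\<lambda>j. cmod (x j)) F"
    using submat_norm_bound[OF assms, of a x]
    by (simp add: L2_set_cmod_scale mult_left_mono mult.assoc)
qed (simp add: submat_norm_nonneg assms)

lemma matrix_norm_upper:
  "bounded_matrix a \<Longrightarrow> finite F \<Longrightarrow> submat_norm F a \<le> matrix_norm a"
  unfolding matrix_norm_def bounded_matrix_def
  by (rule cSUP_upper) (auto intro: bdd_aboveI2)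

lemma matrix_norm_least: "(\<And>F. finite F \<Longrightarrow> submat_norm F a \<le> K) \<Longrightarrow> matrix_norm a \<le> K"
  unfolding matrix_norm_def by (rule cSUP_least) auto

lemma matrix_norm_nonneg: "bounded_matrix a \<Longrightarrow> 0 \<le> matrix_norm a"
  using matrix_norm_upper[of a "{}"] submat_norm_nonneg[of "{}" a] by simp

lemma submat_norm_add_bound:
  "bounded_matrix a \<Longrightarrow> bounded_matrix b \<Longrightarrow> finite F \<Longrightarrow>
    submat_norm F (\<lambda>i j. a i j + b i j) \<le> matrix_norm a + matrix_norm b"
  by (rule order_trans[OF submat_norm_add_le]) (auto intro: add_mono matrix_norm_upper)

lemma submat_norm_scale_bound:
  "bounded_matrix a \<Longrightarrow> finite F \<Longrightarrow>
    submat_norm F (\<lambda>i j. c * a i j) \<le> cmod c * matrix_norm a"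
  by (rule order_trans[OF submat_norm_scale_le]) (auto intro: mult_left_mono matrix_norm_upper)

lemma bounded_matrix_zero: "bounded_matrix (\<lambda>i j. 0)"
  unfolding bounded_matrix_def
  by (rule exI[of _ 0]) (auto intro!: submat_norm_leI simp: submat_apply_def L2_set_0')

lemma bounded_matrix_add:
  "bounded_matrix a \<Longrightarrow> bounded_matrix b \<Longrightarrow> bounded_matrix (\<lambda>i j. a i j + b i j)"
  unfolding bounded_matrix_def[of "\<lambda>i j. a i j + b i j"] using submat_norm_add_bound by blast

lemma bounded_matrix_scale: "bounded_matrix a \<Longrightarrow> bounded_matrix (\<lambda>i j. c * a i j)"
  unfolding bounded_matrix_def[of "\<lambda>i j. c * a i j"] using submat_norm_scale_bound by blast

lemma matrix_norm_scale_le: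
  "bounded_matrix a \<Longrightarrow> matrix_norm (\<lambda>i j. c * a i j) \<le> cmod c * matrix_norm a"
  by (intro matrix_norm_least submat_norm_scale_bound)

lemma matrix_norm_scale:
  assumes "bounded_matrix a"
  shows "matrix_norm (\<lambda>i j. c * a i j) = cmod c * matrix_norm a"
proof (cases "c = 0")
  case True
  then show ?thesis
    using matrix_norm_scale_le[OF assms, of c] matrix_norm_nonneg[OF bounded_matrix_scale[OF assms, of c]]
    by simp
next
  case False
  have "matrix_norm (\<lambda>i j. inverse c * (c * a i j)) \<le> cmod (inverse c) * matrix_norm (\<lambda>i j. c * a i j)"
    by (rule matrix_norm_scale_le[OF bounded_matrix_scale[OF assms]])
  then have "cmod c * matrix_norm a \<le> matrix_norm (\<lambda>i j. c * a i j)"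
    using False by (simp add: norm_inverse norm_divide field_simps flip: mult.assoc)
  then show ?thesis
    using matrix_norm_scale_le[OF assms, of c] by simp
qed

lemma rect_bound:
  assumes "bounded_matrix a" "finite F" "finite G"
  shows "L2_set (\<lambda>i. cmod (\<Sum>j\<in>G. a i j * x j)) F \<le> matrix_norm a * L2_set (\<lambda>j. cmod (x j)) G"
proof -
  define H where "H = F \<union> G"
  define y where "y = (\<lambda>j. if j \<in> G then x j else 0)"
  have H: "finite H" "F \<subseteq> H" "G \<subseteq> H"
    using assms by (auto simp: H_def)
  have app: "submat_apply H a y i = (\<Sum>j\<in>G. a i j * x j)" for i
    unfolding submat_apply_def
    by (rule sum.mono_neutral_cong_right) (use H in \<open>auto simp: y_def\<close>)
  have ny: "L2_set (\<lambda>j. cmod (y j)) H = L2_set (\<lambda>j. cmod (x j)) G"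
    unfolding L2_set_def
    by (rule arg_cong[where f = sqrt], rule sum.mono_neutral_cong_right)
       (use H in \<open>auto simp: y_def\<close>)
  have "L2_set (\<lambda>i. cmod (\<Sum>j\<in>G. a i j * x j)) F \<le> L2_set (\<lambda>i. cmod (submat_apply H a y i)) H"
    unfolding app L2_set_def using H by (intro real_sqrt_le_mono sum_mono2) auto
  also have "\<dots> \<le> submat_norm H a * L2_set (\<lambda>j. cmod (y j)) H"
    by (rule submat_norm_bound[OF H(1)])
  also have "\<dots> \<le> matrix_norm a * L2_set (\<lambda>j. cmod (x j)) G"
    unfolding ny by (intro mult_right_mono matrix_norm_upper assms H) simp
  finally show ?thesis .
qed

lemma column_bound:
  assumes "bounded_matrix a" "finite F"
  shows "L2_set (\<lambda>i. cmod (a i j)) F \<le> matrix_norm a"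
  using rect_bound[OF assms, of "{j}" "\<lambda>_. 1"] by (simp add: L2_set_def)

lemma row_bound:
  assumes "bounded_matrix a" "finite G"
  shows "L2_set (\<lambda>j. cmod (a i j)) G \<le> matrix_norm a"
proof -
  define r where "r = L2_set (\<lambda>j. cmod (a i j)) G"
  have "(\<Sum>j\<in>G. a i j * cnj (a i j)) = complex_of_real (r\<^sup>2)"
    by (simp add: r_def L2_set_def sum_nonneg complex_norm_square flip: of_real_power)
  moreover have "cmod (\<Sum>j\<in>G. a i j * cnj (a i j)) \<le> matrix_norm a * r"
    using rect_bound[OF assms(1) _ assms(2), of "{i}" "\<lambda>j. cnj (a i j)"] by (simp add: r_def)
  ultimately have "r\<^sup>2 \<le> matrix_norm a * r"
    by (simp add: norm_power)
  moreover have "0 \<le> r"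
    by (simp add: r_def)
  ultimately show ?thesis
    using matrix_norm_nonneg[OF assms(1)]
    by (cases "r = 0") (auto simp: power2_eq_square simp flip: r_def)
qed

lemma matrix_prod_summable:
  assumes "bounded_matrix a" "bounded_matrix b"
  shows "(\<lambda>\<xi>. a i \<xi> * b \<xi> j) summable_on UNIV"
proof (rule abs_summable_summable, rule nonneg_bdd_above_summable_on)
  show "bdd_above (sum (\<lambda>\<xi>. cmod (a i \<xi> * b \<xi> j)) ` {F. F \<subseteq> UNIV \<and> finite F})"
  proof (rule bdd_aboveI2)
    fix F :: "'a set" assume "F \<in> {F. F \<subseteq> UNIV \<and> finite F}"
    then have F: "finite F" by simp
    have "(\<Sum>\<xi>\<in>F. cmod (a i \<xi> * b \<xi> j))
        \<le> L2_set (\<lambda>\<xi>. cmod (a i \<xi>)) F * L2_set (\<lambda>\<xi>. cmod (b \<xi> j)) F"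
      using L2_set_mult_ineq[of "\<lambda>\<xi>. cmod (a i \<xi>)" "\<lambda>\<xi>. cmod (b \<xi> j)" F]
      by (simp add: norm_mult)
    also have "\<dots> \<le> matrix_norm a * matrix_norm b"
      by (intro mult_mono row_bound column_bound assms F matrix_norm_nonneg) simp
    finally show "(\<Sum>\<xi>\<in>F. cmod (a i \<xi> * b \<xi> j)) \<le> matrix_norm a * matrix_norm b" .
  qed
qed simp

lemma submat_norm_prod_bound:
  assumes a: "bounded_matrix a" and b: "bounded_matrix b" and F: "finite F"
  shows "submat_norm F (matrix_prod a b) \<le> matrix_norm a * matrix_norm b"
proof (rule submat_norm_leI)
  fix x :: "'a \<Rightarrow> complex"
  let ?p = "\<lambda>G i j. \<Sum>\<xi>\<in>G. a i \<xi> * b \<xi> j"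
  have "((\<lambda>G. L2_set (\<lambda>i. cmod (submat_apply F (?p G) x i)) F)
      \<longlongrightarrow> L2_set (\<lambda>i. cmod (submat_apply F (matrix_prod a b) x i)) F) (finite_subsets_at_top UNIV)"
    unfolding L2_set_def submat_apply_def matrix_prod_def
    by (intro tendsto_intros infsum_tendsto matrix_prod_summable a b)
  then show "L2_set (\<lambda>i. cmod (submat_apply F (matrix_prod a b) x i)) F
      \<le> matrix_norm a * matrix_norm b * L2_set (\<lambda>j. cmod (x j)) F"
  proof (rule tendsto_upperbound)
    show "\<forall>\<^sub>F G in finite_subsets_at_top UNIV. L2_set (\<lambda>i. cmod (submat_apply F (?p G) x i)) F
        \<le> matrix_norm a * matrix_norm b * L2_set (\<lambda>j. cmod (x j)) F"
    proof (rule eventually_finite_subsets_at_top_weakI)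
      fix G :: "'a set" assume G: "finite G"
      have "submat_apply F (?p G) x i = (\<Sum>\<xi>\<in>G. a i \<xi> * (\<Sum>j\<in>F. b \<xi> j * x j))" for i
        unfolding submat_apply_def sum_distrib_right sum_distrib_left
        by (subst sum.swap) (simp add: mult.assoc)
      then have "L2_set (\<lambda>i. cmod (submat_apply F (?p G) x i)) F
          \<le> matrix_norm a * L2_set (\<lambda>\<xi>. cmod (\<Sum>j\<in>F. b \<xi> j * x j)) G"
        using rect_bound[OF a F G] by simp
      also have "\<dots> \<le> matrix_norm a * (matrix_norm b * L2_set (\<lambda>j. cmod (x j)) F)"
        by (intro mult_left_mono rect_bound b G F matrix_norm_nonneg a)
      finally show "L2_set (\<lambda>i. cmod (submat_apply F (?p G) x i)) F
          \<le> matrix_norm a * matrix_norm b * L2_set (\<lambda>j. cmod (x j)) F"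
        by (simp add: mult.assoc)
    qed
  qed simp
qed (simp add: matrix_norm_nonneg a b)

lemma bounded_matrix_prod:
  "bounded_matrix a \<Longrightarrow> bounded_matrix b \<Longrightarrow> bounded_matrix (matrix_prod a b)"
  unfolding bounded_matrix_def[of "matrix_prod a b"] using submat_norm_prod_bound by blast


section \<open>The normed algebra of bounded matrices\<close>

text \<open>The index set is the whole type \<open>'i\<close>.\<close>

typedef 'i bmat = "{a :: 'i \<Rightarrow> 'i \<Rightarrow> complex. bounded_matrix a}"
  morphisms entry Bmat
  using bounded_matrix_zero by blast

setup_lifting type_definition_bmat

lift_definition scaleC_bmat :: "complex \<Rightarrow> 'i bmat \<Rightarrow> 'i bmat"
  is "\<lambda>c a i j. c * a i j"
  by (rule bounded_matrix_scale)

instantiation bmat :: (type) real_normed_vector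
begin

lift_definition zero_bmat :: "'a bmat" is "\<lambda>i j. 0"
  by (rule bounded_matrix_zero)

lift_definition plus_bmat :: "'a bmat \<Rightarrow> 'a bmat \<Rightarrow> 'a bmat" is "\<lambda>a b i j. a i j + b i j"
  by (rule bounded_matrix_add)

lift_definition uminus_bmat :: "'a bmat \<Rightarrow> 'a bmat" is "\<lambda>a i j. - a i j"
  using bounded_matrix_scale[of _ "-1"] by simp

lift_definition minus_bmat :: "'a bmat \<Rightarrow> 'a bmat \<Rightarrow> 'a bmat" is "\<lambda>a b i j. a i j - b i j"
  subgoal for a b
    using bounded_matrix_add[of a, OF _ bounded_matrix_scale[of b "-1"]] by simp
  done

lift_definition scaleR_bmat :: "real \<Rightarrow> 'a bmat \<Rightarrow> 'a bmat"
  is "\<lambda>r a i j. complex_of_real r * a i j"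
  by (rule bounded_matrix_scale)

lift_definition norm_bmat :: "'a bmat \<Rightarrow> real" is matrix_norm .

definition "sgn_bmat (a :: 'a bmat) = scaleR (inverse (norm a)) a"

definition "dist_bmat (a :: 'a bmat) b = norm (a - b)"

definition "(uniformity :: ('a bmat \<times> 'a bmat) filter) =
  (INF e\<in>{0 <..}. principal {(x, y). dist x y < e})"

definition "open_bmat (U :: 'a bmat set) \<longleftrightarrow>
  (\<forall>x\<in>U. eventually (\<lambda>(x', y). x' = x \<longrightarrow> y \<in> U) uniformity)"

instance
proof
  fix a b c :: "'a bmat" and r s :: real
  show "a + b + c = a + (b + c)" by transfer (simp add: add.assoc)
  show "a + b = b + a" by transfer (simp add: add.commute)
  show "0 + a = a" by transfer simp
  show "- a + a = 0" by transfer simp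
  show "a - b = a + - b" by transfer simp
  show "r *\<^sub>R (a + b) = r *\<^sub>R a + r *\<^sub>R b" by transfer (simp add: distrib_left)
  show "(r + s) *\<^sub>R a = r *\<^sub>R a + s *\<^sub>R a" by transfer (simp add: distrib_right)
  show "r *\<^sub>R s *\<^sub>R a = (r * s) *\<^sub>R a" by transfer (simp add: mult.assoc)
  show "1 *\<^sub>R a = a" by transfer simp
  show "dist a b = norm (a - b)" by (rule dist_bmat_def)
  show "sgn a = scaleR (inverse (norm a)) a" by (rule sgn_bmat_def)
  show "(uniformity :: ('a bmat \<times> 'a bmat) filter) =
      (INF e\<in>{0 <..}. principal {(x, y). dist x y < e})"
    by (rule uniformity_bmat_def)
  show "open U \<longleftrightarrow> (\<forall>x\<in>U. eventually (\<lambda>(x', y). x' = x \<longrightarrow> y \<in> U) uniformity)"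
    for U :: "'a bmat set"
    by (rule open_bmat_def)
  show "norm (a + b) \<le> norm a + norm b"
    by transfer (intro matrix_norm_least submat_norm_add_bound)
  show "norm (r *\<^sub>R a) = \<bar>r\<bar> * norm a"
    by transfer (simp add: matrix_norm_scale)
  show "norm a = 0 \<longleftrightarrow> a = 0"
  proof transfer
    fix a :: "'a \<Rightarrow> 'a \<Rightarrow> complex" assume a: "bounded_matrix a"
    show "matrix_norm a = 0 \<longleftrightarrow> a = (\<lambda>i j. 0)"
    proof
      assume 0: "matrix_norm a = 0"
      have "a i j = 0" for i j
        using column_bound[OF a, of "{i}" j] by (simp add: 0 L2_set_def)
      then show "a = (\<lambda>i j. 0)" by blast
    next
      assume "a = (\<lambda>i j. 0)"
      then show "matrix_norm a = 0"
        using matrix_norm_scale[OF a, of 0] by simp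
    qed
  qed
qed

end

instantiation bmat :: (type) times
begin

lift_definition times_bmat :: "'a bmat \<Rightarrow> 'a bmat \<Rightarrow> 'a bmat" is matrix_prod
  by (rule bounded_matrix_prod)

instance ..

end

lemma norm_mult_bmat_le: "norm (a * b) \<le> norm a * norm (b :: 'i bmat)"
  by transfer (intro matrix_norm_least submat_norm_prod_bound)


section \<open>Continuous matrix-valued maps\<close>

text \<open>
  Maps on the space \<open>Q\<close> are represented by total functions that vanish outside \<open>topspace Q\<close>;
  this set is stable under the pointwise operations of \<^theory>\<open>HOL-Library.Function_Algebras\<close>.
  The topology on the codomain is that of the norm.
\<close>

definition continuous_maps :: "'q topology \<Rightarrow> ('q \<Rightarrow> 'i bmat) set"
  where "continuous_maps Q =
    {f. continuous_map Q euclidean f \<and> (\<forall>q. q \<notin> topspace Q \<longrightarrow> f q = 0)}"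

definition scaleC_map :: "complex \<Rightarrow> ('q \<Rightarrow> 'i bmat) \<Rightarrow> 'q \<Rightarrow> 'i bmat"
  where "scaleC_map c f = (\<lambda>q. scaleC_bmat c (f q))"


section \<open>Derivations and 2-local derivations\<close>

text \<open>\<open>A\<close> is the carrier of a complex algebra with scalar multiplication \<open>smul\<close>.\<close>

definition derivation ::
    "(complex \<Rightarrow> 'a \<Rightarrow> 'a) \<Rightarrow> 'a::{plus,times} set \<Rightarrow> ('a \<Rightarrow> 'a) \<Rightarrow> bool"
  where "derivation smul A D \<longleftrightarrow>
    D \<in> A \<rightarrow> A \<and>
    (\<forall>x\<in>A. \<forall>y\<in>A. D (x + y) = D x + D y) \<and>
    (\<forall>c. \<forall>x\<in>A. D (smul c x) = smul c (D x)) \<and>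
    (\<forall>x\<in>A. \<forall>y\<in>A. D (x * y) = D x * y + x * D y)"

definition two_local_derivation ::
    "(complex \<Rightarrow> 'a \<Rightarrow> 'a) \<Rightarrow> 'a::{plus,times} set \<Rightarrow> ('a \<Rightarrow> 'a) \<Rightarrow> bool"
  where "two_local_derivation smul A \<Delta> \<longleftrightarrow>
    \<Delta> \<in> A \<rightarrow> A \<and>
    (\<forall>x\<in>A. \<forall>y\<in>A. \<exists>D. derivation smul A D \<and> \<Delta> x = D x \<and> \<Delta> y = D y)"

end

theory Submission
  imports Defs
begin

text \<open>
  Two observations carry the proof: derivations of \<open>C(Q, M)\<close> act fibre by fibre, and in a single
  fibre \<open>M\<close> the values of a derivation on matrix units determine it by a formula that is linear in
  its argument. Herstein's theorem on Jordan derivations supplies the rest.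
  Here \<open>M\<close> is the algebra of bounded matrices.

  \<^emph>\<open>Reduction to a fibre.\<close> If \<open>x\<close> vanishes at \<open>q\<close>, then \<open>x\<close> is the product of \<open>\<surd>\<parallel>x\<parallel> \<cdot> 1\<close> and
  \<open>x / \<surd>\<parallel>x\<parallel>\<close>, two continuous maps that both vanish at \<open>q\<close>; by the Leibniz rule every derivation sends
  \<open>x\<close> to a map that vanishes at \<open>q\<close> (\<open>derivation_vanishes\<close>). Hence \<open>D x q\<close> depends only on \<open>x q\<close>, and
  evaluating at constant maps turns \<open>D\<close> into a derivation of \<open>M\<close>. As \<open>\<Delta>\<close> agrees with some
  derivation on any two maps, \<open>\<Delta> x q\<close> also depends only on \<open>x q\<close>, so that \<open>\<Delta>\<close> is a
  family of 2-local derivations \<open>\<delta>\<close> of \<open>M\<close>, one for each point of \<open>Q\<close>.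

  \<^emph>\<open>Linearity in a fibre.\<close> For the matrix unit \<open>e = e\<^sub>i\<^sub>j\<close> one has \<open>e x e = x\<^sub>j\<^sub>i e\<close>. Applying a
  derivation that agrees with \<open>\<delta>\<close> at \<open>x\<close> and \<open>e\<close> and comparing the entries at \<open>(i, j)\<close> gives
  \<open>\<delta>(x)\<^sub>j\<^sub>i = x\<^sub>j\<^sub>i \<delta>(e)\<^sub>i\<^sub>j - (\<delta>(e) x)\<^sub>i\<^sub>i - (x \<delta>(e))\<^sub>j\<^sub>j\<close> (\<open>derivation_bmat_entry\<close>). The right-hand side
  involves \<open>\<delta>\<close> only at \<open>e\<close>, so \<open>\<delta>\<close> is linear.

  \<^emph>\<open>Leibniz rule in a fibre.\<close> Agreement with a derivation at \<open>x\<close> and \<open>x\<^sup>2\<close> makes the linear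
  map \<open>\<delta>\<close> a Jordan derivation, and by Herstein's theorem (\<open>jordan_derivation_prime_ring\<close>) a Jordan
  derivation of a prime ring without 2-torsion is a derivation. The ring \<open>M\<close> is prime because
  \<open>a e\<^sub>j\<^sub>k b\<close> has the entries \<open>a\<^sub>i\<^sub>j b\<^sub>k\<^sub>l\<close>.

  The ring structure of \<open>M\<close> has to be established first. Its only delicate point is associativity
  (\<open>bmat_assoc\<close>), since the double series for the entries of \<open>a b c\<close> need not converge
  absolutely.
\<close>

section \<open>The unital normed algebra of bounded matrices\<close>

lemma bmat_eqI: "(\<And>i j. entry a i j = entry b i j) \<Longrightarrow> a = b"
  by (simp add: fun_eq_iff flip: entry_inject)

lemmas entry_simps [simp] = zero_bmat.rep_eq plus_bmat.rep_eq minus_bmat.rep_eq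
  scaleR_bmat.rep_eq scaleC_bmat.rep_eq

lemma bounded_matrix_entry: "bounded_matrix (entry a)"
  using entry[of a] by simp

lemma norm_entry_le: "cmod (entry a i j) \<le> norm a"
  using column_bound[OF bounded_matrix_entry, of "{i}" a j]
  by (simp add: norm_bmat.rep_eq L2_set_def)

lemma entry_times: "entry (a * b) i j = (\<Sum>\<^sub>\<infinity>\<xi>. entry a i \<xi> * entry b \<xi> j)"
  by (simp add: times_bmat.rep_eq matrix_prod_def)

lemma entry_times_summable: "(\<lambda>\<xi>. entry a i \<xi> * entry b \<xi> j) summable_on UNIV"
  by (rule matrix_prod_summable) (rule bounded_matrix_entry)+

text \<open>
  By the Cauchy-Schwarz inequality a matrix with a single nonzero row has operator norm at most the
  \<open>\<ell>\<^sub>2\<close> norm of that row.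
\<close>

lemma submat_norm_row_le:
  assumes F: "finite F"
    and K: "\<And>H. finite H \<Longrightarrow> H \<subseteq> G \<Longrightarrow> L2_set (\<lambda>\<xi>. cmod (u \<xi>)) H \<le> K"
  shows "submat_norm F (\<lambda>k \<xi>. if k = i \<and> \<xi> \<in> G then u \<xi> else 0) \<le> K"
proof (rule submat_norm_leI)
  show "0 \<le> K"
    using K[of "{}"] by simp
  fix x :: "'a \<Rightarrow> complex"
  define s where "s = (\<Sum>\<xi>\<in>F \<inter> G. u \<xi> * x \<xi>)"
  have app: "submat_apply F (\<lambda>k \<xi>. if k = i \<and> \<xi> \<in> G then u \<xi> else 0) x k
      = (if k = i then s else 0)" for k
    unfolding submat_apply_def s_def using F
    by (auto simp: sum.inter_restrict if_distrib cong: if_cong intro!: sum.cong)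
  have "L2_set (\<lambda>k. cmod (if k = i then s else 0)) F \<le> (\<Sum>k\<in>F. cmod (if k = i then s else 0))"
    by (rule L2_set_le_sum) simp
  also have "\<dots> \<le> cmod s"
    using F by (simp add: if_distrib cong: if_cong)
  also have "\<dots> \<le> (\<Sum>\<xi>\<in>F \<inter> G. \<bar>cmod (u \<xi>)\<bar> * \<bar>cmod (x \<xi>)\<bar>)"
    unfolding s_def by (rule order_trans[OF norm_sum]) (simp add: norm_mult)
  also have "\<dots> \<le> L2_set (\<lambda>\<xi>. cmod (u \<xi>)) (F \<inter> G) * L2_set (\<lambda>\<xi>. cmod (x \<xi>)) (F \<inter> G)"
    by (rule L2_set_mult_ineq)
  also have "\<dots> \<le> K * L2_set (\<lambda>\<xi>. cmod (x \<xi>)) F"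
    using F by (intro mult_mono K) (auto simp: \<open>0 \<le> K\<close> L2_set_def sum_nonneg intro!: sum_mono2)
  finally show "L2_set (\<lambda>k. cmod (submat_apply F (\<lambda>k \<xi>. if k = i \<and> \<xi> \<in> G then u \<xi> else 0) x k)) F
      \<le> K * L2_set (\<lambda>\<xi>. cmod (x \<xi>)) F"
    by (simp only: app)
qed

text \<open>
  Row \<open>i\<close> of \<open>a\<close> restricted to the columns in \<open>G\<close>, as a matrix whose other rows are zero.
\<close>

lift_definition row_part :: "'i \<Rightarrow> 'i set \<Rightarrow> 'i bmat \<Rightarrow> 'i bmat"
  is "\<lambda>i G a k \<xi>. if k = i \<and> \<xi> \<in> G then a i \<xi> else 0"
  subgoal for i G a
    unfolding bounded_matrix_def[of "\<lambda>k \<xi>. if k = i \<and> \<xi> \<in> G then a i \<xi> else 0"]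
    by (intro exI[of _ "matrix_norm a"] allI impI submat_norm_row_le row_bound)
  done

lemma norm_row_part_le:
  assumes "\<And>H. finite H \<Longrightarrow> H \<subseteq> G \<Longrightarrow> L2_set (\<lambda>\<xi>. cmod (entry a i \<xi>)) H \<le> K"
  shows "norm (row_part i G a) \<le> K"
  using assms by transfer (intro matrix_norm_least submat_norm_row_le)

text \<open>
  Rows of bounded matrices are square summable, so the part of a row outside a large finite set is
  small even in the operator norm.
\<close>

lemma row_tail_small:
  assumes "e > 0"
  shows "\<exists>G. finite G \<and> norm (row_part i (- G) a) \<le> e"
proof -
  let ?f = "\<lambda>\<xi>. (cmod (entry a i \<xi>))\<^sup>2"
  have sums: "?f summable_on UNIV"
  proof (rule nonneg_bdd_above_summable_on)
    show "bdd_above (sum ?f ` {F. F \<subseteq> UNIV \<and> finite F})"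
    proof (rule bdd_aboveI2)
      fix F :: "'a set" assume "F \<in> {F. F \<subseteq> UNIV \<and> finite F}"
      then have "L2_set (\<lambda>\<xi>. cmod (entry a i \<xi>)) F \<le> norm a"
        using row_bound[OF bounded_matrix_entry] by (simp add: norm_bmat.rep_eq)
      then show "sum ?f F \<le> (norm a)\<^sup>2"
        unfolding L2_set_def by (rule sqrt_le_D)
    qed
  qed simp
  have "\<forall>\<^sub>F G in finite_subsets_at_top UNIV. infsum ?f UNIV - e\<^sup>2 < sum ?f G"
    by (rule order_tendstoD(1)[OF infsum_tendsto[OF sums]]) (use assms in simp)
  then obtain G where G: "finite G" "infsum ?f UNIV - e\<^sup>2 < sum ?f G"
    unfolding eventually_finite_subsets_at_top by blast
  have "norm (row_part i (- G) a) \<le> e"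
  proof (rule norm_row_part_le)
    fix H :: "'a set" assume H: "finite H" "H \<subseteq> - G"
    have "sum ?f G + sum ?f H = sum ?f (G \<union> H)"
      using G H by (subst sum.union_disjoint) auto
    also have "\<dots> \<le> infsum ?f UNIV"
      using G H by (intro finite_sum_le_infsum sums) auto
    finally have "sum ?f H \<le> e\<^sup>2"
      using G(2) by simp
    then show "L2_set (\<lambda>\<xi>. cmod (entry a i \<xi>)) H \<le> e"
      unfolding L2_set_def using assms by (simp add: real_le_lsqrt sum_nonneg)
  qed
  then show ?thesis
    using G(1) by blast
qed

lemma bmat_distrib:
  fixes a b c :: "'i bmat"
  shows "(a + b) * c = a * c + b * c" and "a * (b + c) = a * b + a * c"
  by (rule bmat_eqI, simp add: entry_times distrib_left distrib_right
    infsum_add entry_times_summable)+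

lemma has_sum_finite_sum:
  fixes f :: "'a \<Rightarrow> 'b \<Rightarrow> 'c::topological_comm_monoid_add"
  assumes "finite G" and "\<And>\<xi>. (f \<xi> has_sum s \<xi>) A"
  shows "((\<lambda>\<eta>. \<Sum>\<xi>\<in>G. f \<xi> \<eta>) has_sum (\<Sum>\<xi>\<in>G. s \<xi>)) A"
  using assms(1) by induction (simp_all add: assms(2) has_sum_add)

text \<open>
  The entry of \<open>a b c\<close> at \<open>(i, j)\<close> involves only row \<open>i\<close> of \<open>a\<close>. If this row has finite support,
  associativity is an interchange of a finite sum with a series. In general the row is split into a
  finitely supported part and a tail; the tail contributes at most its norm times
  \<open>\<parallel>b\<parallel> \<parallel>c\<parallel>\<close> to either bracketing, which is arbitrarily small.
\<close>

lemma bmat_assoc: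
  fixes a b c :: "'i bmat"
  shows "a * b * c = a * (b * c)"
proof (rule bmat_eqI)
  fix i j
  have finite_row: "entry (row_part i G a * b * c) i j = entry (row_part i G a * (b * c)) i j"
    if G: "finite G" for G
  proof -
    have row: "entry (row_part i G a * d) i k = (\<Sum>\<xi>\<in>G. entry a i \<xi> * entry d \<xi> k)" for d k
      unfolding entry_times row_part.rep_eq infsum_finite[OF G, symmetric]
      by (rule infsum_cong_neutral) auto
    have "entry (row_part i G a * b * c) i j
        = (\<Sum>\<^sub>\<infinity>\<eta>. \<Sum>\<xi>\<in>G. entry a i \<xi> * (entry b \<xi> \<eta> * entry c \<eta> j))"
      by (simp add: entry_times[of "_ * b"] row sum_distrib_right mult.assoc)
    also have "\<dots> = (\<Sum>\<xi>\<in>G. \<Sum>\<^sub>\<infinity>\<eta>. entry a i \<xi> * (entry b \<xi> \<eta> * entry c \<eta> j))"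
      by (rule infsumI, rule has_sum_finite_sum[OF G])
         (intro has_sum_infsum summable_on_cmult_right entry_times_summable)
    also have "\<dots> = entry (row_part i G a * (b * c)) i j"
      by (simp add: row entry_times[of b] infsum_cmult_right')
    finally show ?thesis .
  qed
  have row: "entry (row_part i UNIV a * d) i k = entry (a * d) i k" for d k
    by (simp add: entry_times row_part.rep_eq)
  have row_split: "row_part i UNIV a = row_part i G a + row_part i (- G) a" for G
    by (rule bmat_eqI) (simp add: row_part.rep_eq)
  have split: "entry (a * d) i k = entry (row_part i G a * d) i k + entry (row_part i (- G) a * d) i k"
    for G d k
    using row[of d k] unfolding row_split[of G] by (simp add: bmat_distrib(1))
  have split3: "entry (a * b * c) i j
      = entry (row_part i G a * b * c) i j + entry (row_part i (- G) a * b * c) i j" for G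
    by (simp add: entry_times[of "_ * b"] split[of b _ G] distrib_right infsum_add entry_times_summable)
  have "cmod (entry (a * b * c) i j - entry (a * (b * c)) i j) \<le> 0"
  proof (rule field_le_epsilon)
    fix e :: real assume "e > 0"
    \<comment> \<open>The summand 1 keeps \<open>K\<close> positive when \<open>b\<close> or \<open>c\<close> is zero.\<close>
    define K where "K = norm b * norm c + 1"
    have K: "K > 0" "norm b * norm c \<le> K"
      by (simp_all add: K_def add_nonneg_pos)
    have "e / (2 * K) > 0"
      using \<open>e > 0\<close> K by simp
    then obtain G where G: "finite G" "norm (row_part i (- G) a) \<le> e / (2 * K)"
      using row_tail_small[of "e / (2 * K)" i a] by blast
    let ?t = "row_part i (- G) a"
    have "norm ?t * (norm b * norm c) \<le> e / (2 * K) * K"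
      using K G \<open>e / (2 * K) > 0\<close> by (intro mult_mono) auto
    also have "\<dots> = e / 2"
      using K by simp
    finally have small: "norm ?t * (norm b * norm c) \<le> e / 2" .
    have "norm (?t * b * c) \<le> norm ?t * norm b * norm c"
      by (rule order_trans[OF norm_mult_bmat_le]) (simp add: mult_right_mono norm_mult_bmat_le)
    then have 1: "cmod (entry (?t * b * c) i j) \<le> e / 2"
      using norm_entry_le[of "?t * b * c" i j] small by (simp add: mult.assoc)
    have "norm (?t * (b * c)) \<le> norm ?t * (norm b * norm c)"
      by (rule order_trans[OF norm_mult_bmat_le]) (simp add: mult_left_mono norm_mult_bmat_le)
    then have 2: "cmod (entry (?t * (b * c)) i j) \<le> e / 2"
      using norm_entry_le[of "?t * (b * c)" i j] small by simp
    have "entry (a * b * c) i j - entry (a * (b * c)) i j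
        = entry (?t * b * c) i j - entry (?t * (b * c)) i j"
      by (simp add: split3[of G] split[of _ _ G] finite_row G)
    also have "cmod \<dots> \<le> e / 2 + e / 2"
      by (rule order_trans[OF norm_triangle_ineq4]) (intro add_mono 1 2)
    finally show "cmod (entry (a * b * c) i j - entry (a * (b * c)) i j) \<le> 0 + e"
      by simp
  qed
  then show "entry (a * b * c) i j = entry (a * (b * c)) i j"
    by simp
qed

lemma submat_norm_identity:
  assumes "finite F"
  shows "submat_norm F (\<lambda>i j. if i = j then 1 else 0) \<le> 1"
proof (rule submat_norm_leI)
  fix x :: "'a \<Rightarrow> complex"
  have "submat_apply F (\<lambda>i j. if i = j then 1 else 0) x i = x i" if "i \<in> F" for i
    using assms that by (simp add: submat_apply_def if_distrib[of "\<lambda>c. c * _"] cong: if_cong)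
  then show "L2_set (\<lambda>i. cmod (submat_apply F (\<lambda>i j. if i = j then 1 else 0) x i)) F
      \<le> 1 * L2_set (\<lambda>j. cmod (x j)) F"
    by (simp cong: L2_set_cong)
qed simp

instantiation bmat :: (type) one
begin

lift_definition one_bmat :: "'a bmat" is "\<lambda>i j. if i = j then 1 else 0"
  unfolding bounded_matrix_def using submat_norm_identity by blast

instance ..

end

lemma infsum_single:
  fixes f :: "'a \<Rightarrow> 'b::{comm_monoid_add, t2_space}"
  assumes "\<And>\<xi>. \<xi> \<noteq> k \<Longrightarrow> f \<xi> = 0"
  shows "(\<Sum>\<^sub>\<infinity>\<xi>. f \<xi>) = f k"
  using infsum_cong_neutral[of UNIV "{k}" f f] assms by simp

instance bmat :: (type) real_normed_algebra_1
proof
  fix a b c :: "'a bmat" and r :: real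
  show "a * b * c = a * (b * c)"
    by (rule bmat_assoc)
  show "(a + b) * c = a * c + b * c" "a * (b + c) = a * b + a * c"
    by (rule bmat_distrib)+
  show "r *\<^sub>R a * b = r *\<^sub>R (a * b)" "a * r *\<^sub>R b = r *\<^sub>R (a * b)"
    by (rule bmat_eqI, simp add: entry_times mult.assoc mult.left_commute infsum_cmult_right')+
  show "1 * a = a"
    by (rule bmat_eqI) (subst entry_times, subst infsum_single, auto simp: one_bmat.rep_eq)
  show "a * 1 = a"
  proof (rule bmat_eqI)
    show "entry (a * 1) i j = entry a i j" for i j
      unfolding entry_times by (subst infsum_single[of j]) (auto simp: one_bmat.rep_eq)
  qed
  have "entry (1 :: 'a bmat) i i \<noteq> entry 0 i i" for i
    by (simp add: one_bmat.rep_eq)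
  then show "(0 :: 'a bmat) \<noteq> 1"
    by metis
  show "norm (a * b) \<le> norm a * norm b"
    by (rule norm_mult_bmat_le)
  show "norm (1 :: 'a bmat) = 1"
  proof (rule antisym)
    show "norm (1 :: 'a bmat) \<le> 1"
      by transfer (rule matrix_norm_least[OF submat_norm_identity])
    show "1 \<le> norm (1 :: 'a bmat)"
      using norm_entry_le[of "1 :: 'a bmat" i i for i] by (simp add: one_bmat.rep_eq)
  qed
qed


section \<open>Jordan derivations of prime rings\<close>

text \<open>
  The classical linearizations of the Jordan identity. The first polarizes \<open>x\<^sup>2\<close>; the second follows
  from \<open>2 x y x = x \<circ> (x \<circ> y) - x\<^sup>2 \<circ> y\<close> with \<open>x \<circ> y = x y + y x\<close>, which is where 2-torsion
  matters; the third polarizes the second in \<open>x\<close>.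
\<close>

lemma jordan_triple:
  fixes \<delta> :: "'a::ring \<Rightarrow> 'a"
  assumes torsion: "\<And>a::'a. a + a = 0 \<Longrightarrow> a = 0"
    and add: "\<And>x y. \<delta> (x + y) = \<delta> x + \<delta> y"
    and square: "\<And>x. \<delta> (x * x) = \<delta> x * x + x * \<delta> x"
  shows "\<delta> (x * y + y * x) = \<delta> x * y + x * \<delta> y + \<delta> y * x + y * \<delta> x"
    and "\<delta> (x * y * x) = \<delta> x * y * x + x * \<delta> y * x + x * y * \<delta> x"
    and "\<delta> (x * y * z + z * y * x) =
      \<delta> x * y * z + x * \<delta> y * z + x * y * \<delta> z + \<delta> z * y * x + z * \<delta> y * x + z * y * \<delta> x"
proof -
  have jordan: "\<delta> (x * y + y * x) = \<delta> x * y + x * \<delta> y + \<delta> y * x + y * \<delta> x" for x y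
    using square[of "x + y"] square[of x] square[of y] by (simp add: algebra_simps add)
  have triple: "\<delta> (x * y * x) = \<delta> x * y * x + x * \<delta> y * x + x * y * \<delta> x" for x y
  proof -
    let ?d = "\<delta> (x * y * x) - (\<delta> x * y * x + x * \<delta> y * x + x * y * \<delta> x)"
    have "x * (x * y + y * x) + (x * y + y * x) * x
        = x * y * x + x * y * x + (x * x * y + y * (x * x))"
      by (simp add: algebra_simps)
    then have "\<delta> (x * (x * y + y * x) + (x * y + y * x) * x)
        = \<delta> (x * y * x) + \<delta> (x * y * x) + \<delta> (x * x * y + y * (x * x))"
      by (simp only: add)
    then have "?d + ?d = 0"
      unfolding jordan square by (simp add: algebra_simps)
    then show ?thesis
      using torsion[of ?d] by simp
  qed
  show "\<delta> (x * y + y * x) = \<delta> x * y + x * \<delta> y + \<delta> y * x + y * \<delta> x"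
    by (rule jordan)
  show "\<delta> (x * y * x) = \<delta> x * y * x + x * \<delta> y * x + x * y * \<delta> x"
    by (rule triple)
  show "\<delta> (x * y * z + z * y * x) =
      \<delta> x * y * z + x * \<delta> y * z + x * y * \<delta> z + \<delta> z * y * x + z * \<delta> y * x + z * y * \<delta> x"
    using triple[of "x + z" y] triple[of x y] triple[of z y] by (simp add: algebra_simps add)
qed

text \<open>
  The hypothesis \<open>skew\<close> allows exchanging \<open>a\<close> and \<open>b\<close> around any middle factor at the cost of a sign.
  Three such exchanges lead from \<open>(a r b) s (a r b)\<close> back to itself with the opposite sign, so it
  vanishes for every \<open>s\<close>, and primeness gives \<open>a r b = 0\<close>.
\<close>

lemma prime_symmetric_product:
  fixes a b :: "'a::ring"
  assumes torsion: "\<And>a::'a. a + a = 0 \<Longrightarrow> a = 0"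
    and prime: "\<And>a b::'a. (\<And>r. a * r * b = 0) \<Longrightarrow> a = 0 \<or> b = 0"
    and skew: "\<And>r. a * r * b + b * r * a = 0"
  shows "a = 0 \<or> b = 0"
proof (rule prime)
  fix r
  have swap: "b * t * a = - (a * t * b)" for t
    using skew[of t] by (simp add: add_eq_0_iff2)
  have "(a * r * b) * s * (a * r * b) = 0" for s
  proof -
    have "(a * r * b) * s * (a * r * b) = - (b * r * a) * s * (a * r * b)"
      by (simp add: swap)
    also have "\<dots> = - (b * (r * a * s) * a) * r * b"
      by (simp add: mult.assoc)
    also have "\<dots> = (a * (r * a * s) * b) * r * b"
      by (simp only: swap minus_minus)
    also have "\<dots> = a * r * (a * s * b) * r * b"
      by (simp only: mult.assoc)
    also have "\<dots> = - (a * r * (b * s * a) * r * b)"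
      by (simp add: swap)
    finally have "(a * r * b) * s * (a * r * b) = - ((a * r * b) * s * (a * r * b))"
      by (simp add: mult.assoc)
    then show ?thesis
      by (rule torsion[OF eq_neg_iff_add_eq_0[THEN iffD1]])
  qed
  then show "a * r * b = 0"
    using prime by blast
qed

text \<open>
  An abelian group is not the union of two proper subgroups, stated for kernels.
\<close>

lemma additive_union_cover:
  fixes f g :: "'a::ab_group_add \<Rightarrow> 'b::ab_group_add"
  assumes f: "\<And>x y. f (x + y) = f x + f y" and g: "\<And>x y. g (x + y) = g x + g y"
    and cover: "\<And>x. f x = 0 \<or> g x = 0"
  shows "(\<forall>x. f x = 0) \<or> (\<forall>x. g x = 0)"
proof (rule ccontr)
  assume "\<not> ?thesis"
  then obtain x y where "f x \<noteq> 0" "g y \<noteq> 0"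
    by blast
  then show False
    using cover[of x] cover[of y] cover[of "x + y"] by (auto simp: f g)
qed

text \<open>
  Herstein's theorem, by Bresar's argument. Let \<open>J\<close> be the defect of the Leibniz rule and \<open>C\<close> the
  commutator. Evaluating \<open>\<delta>\<close> on \<open>x y r y x + y x r x y\<close> in two ways yields
  \<open>J(x, y) r C(x, y) + C(x, y) r J(x, y) = 0\<close> for all \<open>r\<close>, hence \<open>J(x, y) = 0\<close> or \<open>C(x, y) = 0\<close> for
  each pair. Both are biadditive, so one of them vanishes identically; in a commutative ring \<open>J\<close> is
  symmetric as well as skew-symmetric and vanishes too.
\<close>

lemma jordan_derivation_prime_ring:
  fixes \<delta> :: "'a::ring \<Rightarrow> 'a"
  assumes torsion: "\<And>a::'a. a + a = 0 \<Longrightarrow> a = 0"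
    and prime: "\<And>a b::'a. (\<And>r. a * r * b = 0) \<Longrightarrow> a = 0 \<or> b = 0"
    and add: "\<And>x y. \<delta> (x + y) = \<delta> x + \<delta> y"
    and square: "\<And>x. \<delta> (x * x) = \<delta> x * x + x * \<delta> x"
  shows "\<delta> (x * y) = \<delta> x * y + x * \<delta> y"
proof -
  note jordan = jordan_triple[of \<delta>, OF torsion add square]
  define J where "J x y = \<delta> (x * y) - \<delta> x * y - x * \<delta> y" for x y
  define C where "C x y = x * y - y * x" for x y :: 'a
  have J_skew: "J y x = - J x y" for x y
    using jordan(1)[of x y] by (simp add: J_def add algebra_simps add_eq_0_iff2)
  have J_add: "J (x + x') y = J x y + J x' y" "J x (y + y') = J x y + J x y'" for x x' y y'
    by (simp_all add: J_def add algebra_simps)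
  have C_add: "C (x + x') y = C x y + C x' y" "C x (y + y') = C x y + C x y'" for x x' y y'
    by (simp_all add: C_def algebra_simps)
  have alt: "J x y = 0 \<or> C x y = 0" for x y
  proof (rule prime_symmetric_product[OF torsion prime])
    fix r
    \<comment> \<open>The left-hand side is a sum of two triples \<open>u v u\<close>, the right-hand side has the form
        \<open>u v w + w v u\<close>.\<close>
    have "x * (y * r * y) * x + y * (x * r * x) * y = x * y * r * (y * x) + y * x * r * (x * y)"
      by (simp add: mult.assoc)
    then have "\<delta> (x * (y * r * y) * x) + \<delta> (y * (x * r * x) * y)
        = \<delta> (x * y * r * (y * x) + y * x * r * (x * y))"
      by (metis add)
    then have "J x y * r * (y * x) + x * y * r * J y x + J y x * r * (x * y) + y * x * r * J x y = 0"
      by (simp only: jordan(2,3)) (simp add: J_def algebra_simps)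
    then show "J x y * r * C x y + C x y * r * J x y = 0"
      unfolding J_skew[of y x] C_def by (simp add: algebra_simps)
  qed
  \<comment> \<open>The kernel covering is used twice: in the second argument for fixed \<open>x\<close>, then in the first with
      \<open>J\<close> and \<open>C\<close> read as additive maps into the group of functions.\<close>
  have "(\<forall>y. J x y = 0) \<or> (\<forall>y. C x y = 0)" for x
    by (rule additive_union_cover) (rule J_add(2) C_add(2) alt)+
  then have "J x = 0 \<or> C x = 0" for x
    by (simp add: fun_eq_iff)
  then have "(\<forall>x. J x = 0) \<or> (\<forall>x. C x = 0)"
    by (intro additive_union_cover[of J C]) (simp_all add: fun_eq_iff J_add C_add)
  then have "J x y = 0"
  proof
    assume "\<forall>x. C x = 0"
    then have comm: "u * v = v * u" for u v :: 'a
      by (simp add: C_def fun_eq_iff)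
    have "J x y = J y x"
      unfolding J_def comm[of y x] comm[of y "\<delta> x"] comm[of "\<delta> y" x] by simp
    also have "\<dots> = - J x y"
      by (rule J_skew)
    finally have "J x y = - J x y" .
    then have "J x y + J x y = 0"
      by (rule eq_neg_iff_add_eq_0[THEN iffD1])
    then show ?thesis
      by (rule torsion)
  qed simp
  then show ?thesis
    by (simp add: J_def algebra_simps)
qed


section \<open>2-local derivations of the algebra of bounded matrices\<close>

lift_definition matrix_unit :: "'i \<Rightarrow> 'i \<Rightarrow> 'i bmat"
  is "\<lambda>i j k l. if k = i \<and> l \<in> {j} then 1 else 0"
  subgoal for i j
    unfolding bounded_matrix_def
    by (intro exI[of _ 1] allI impI submat_norm_row_le) (auto simp: subset_singleton_iff L2_set_def)
  done

lemma entry_times_matrix_unit: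
  "entry (a * matrix_unit i j) k l = (if l = j then entry a k i else 0)"
  unfolding entry_times by (subst infsum_single[of i]) (auto simp: matrix_unit.rep_eq)

lemma entry_matrix_unit_times:
  "entry (matrix_unit i j * a) k l = (if k = i then entry a j l else 0)"
  unfolding entry_times by (subst infsum_single[of j]) (auto simp: matrix_unit.rep_eq)

lemma matrix_unit_sandwich:
  "matrix_unit i j * x * matrix_unit i j = scaleC_bmat (entry x j i) (matrix_unit i j)"
  by (rule bmat_eqI) (simp add: entry_times_matrix_unit entry_matrix_unit_times matrix_unit.rep_eq)

lemma bmat_prime:
  fixes a b :: "'i bmat"
  assumes "\<And>r. a * r * b = 0"
  shows "a = 0 \<or> b = 0"
proof (rule ccontr)
  assume "\<not> ?thesis"
  then obtain i j k l where "entry a i j \<noteq> 0" "entry b k l \<noteq> 0"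
    using bmat_eqI[of a 0] bmat_eqI[of b 0] by auto
  moreover have "entry (a * (matrix_unit j k * b)) i l = entry a i j * entry b k l"
    unfolding entry_times[of a] by (subst infsum_single[of j]) (auto simp: entry_matrix_unit_times)
  ultimately show False
    using assms[of "matrix_unit j k"] by (simp add: mult.assoc)
qed

text \<open>
  The derivation is applied to \<open>e x e = x\<^sub>j\<^sub>i e\<close> for the matrix unit \<open>e = e\<^sub>i\<^sub>j\<close>; the term \<open>e D(x) e\<close> of the
  Leibniz rule carries \<open>D(x)\<^sub>j\<^sub>i\<close> at position \<open>(i, j)\<close>.
\<close>

lemma derivation_bmat_entry:
  fixes D :: "'i bmat \<Rightarrow> 'i bmat"
  assumes "derivation scaleC_bmat UNIV D"
  shows "entry (D x) j i = entry x j i * entry (D (matrix_unit i j)) i j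
    - entry (D (matrix_unit i j) * x) i i - entry (x * D (matrix_unit i j)) j j"
proof -
  let ?e = "matrix_unit i j"
  have "scaleC_bmat (entry x j i) (D ?e) = D (?e * x * ?e)"
    using assms by (simp add: derivation_def matrix_unit_sandwich)
  also have "\<dots> = D ?e * x * ?e + ?e * D x * ?e + ?e * (x * D ?e)"
    using assms by (simp add: derivation_def algebra_simps)
  finally have "entry (scaleC_bmat (entry x j i) (D ?e)) i j = entry \<dots> i j"
    by simp
  then show ?thesis
    by (simp add: entry_times_matrix_unit entry_matrix_unit_times)
qed

lemma scaleC_bmat_zero [simp]: "scaleC_bmat c 0 = 0"
  by (rule bmat_eqI) simp

lemma scaleC_bmat_times:
  "scaleC_bmat c a * b = scaleC_bmat c (a * b)"
  "a * scaleC_bmat c b = scaleC_bmat c (a * b)"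
  by (rule bmat_eqI, simp add: entry_times mult.assoc mult.left_commute infsum_cmult_right')+

text \<open>
  The entry formula passes from derivations to \<open>\<delta>\<close> because it involves only the two arguments \<open>x\<close> and
  a matrix unit, at which \<open>\<delta>\<close> agrees with one derivation.
\<close>

lemma two_local_derivation_bmat:
  fixes \<delta> :: "'i bmat \<Rightarrow> 'i bmat"
  assumes "two_local_derivation scaleC_bmat UNIV \<delta>"
  shows "derivation scaleC_bmat UNIV \<delta>"
proof -
  have agree: "\<exists>D. derivation scaleC_bmat UNIV D \<and> \<delta> x = D x \<and> \<delta> y = D y" for x y
    using assms by (simp add: two_local_derivation_def)
  have entries: "entry (\<delta> x) j i = entry x j i * entry (\<delta> (matrix_unit i j)) i j
    - entry (\<delta> (matrix_unit i j) * x) i i - entry (x * \<delta> (matrix_unit i j)) j j" for x i j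
    using agree[of x "matrix_unit i j"] derivation_bmat_entry by metis
  have add: "\<delta> (x + y) = \<delta> x + \<delta> y" for x y
    by (rule bmat_eqI, subst (1) entries, simp only: plus_bmat.rep_eq entries[of x] entries[of y])
       (simp add: algebra_simps)
  have scale: "\<delta> (scaleC_bmat c x) = scaleC_bmat c (\<delta> x)" for c x
    by (rule bmat_eqI, subst (1) entries, simp only: scaleC_bmat.rep_eq entries[of x])
       (simp add: scaleC_bmat_times algebra_simps)
  have square: "\<delta> (x * x) = \<delta> x * x + x * \<delta> x" for x
    using agree[of "x * x" x] by (auto simp: derivation_def)
  have torsion: "a = 0" if "a + a = 0" for a :: "'i bmat"
    using that by (simp flip: scaleR_2)
  have "\<delta> (x * y) = \<delta> x * y + x * \<delta> y" for x y
    by (rule jordan_derivation_prime_ring[OF torsion bmat_prime add square])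
  then show ?thesis
    by (simp add: derivation_def add scale)
qed


section \<open>The algebra of continuous maps, point by point\<close>

lemma continuous_maps_compose:
  assumes "f \<in> continuous_maps Q" and "continuous_on UNIV \<phi>" and "\<phi> 0 = 0"
  shows "(\<lambda>q. \<phi> (f q)) \<in> continuous_maps Q"
  using assms continuous_map_compose[of Q euclidean f euclidean \<phi>]
  by (simp add: continuous_maps_def o_def)

lemma continuous_maps_add: "f \<in> continuous_maps Q \<Longrightarrow> g \<in> continuous_maps Q \<Longrightarrow> f + g \<in> continuous_maps Q"
  by (simp add: continuous_maps_def plus_fun_def continuous_map_add)

lemma continuous_maps_diff: "f \<in> continuous_maps Q \<Longrightarrow> g \<in> continuous_maps Q \<Longrightarrow> f - g \<in> continuous_maps Q"
  by (simp add: continuous_maps_def fun_diff_def continuous_map_diff)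

lemma continuous_maps_times:
  fixes f g :: "'q \<Rightarrow> 'i bmat"
  assumes "f \<in> continuous_maps Q" and "g \<in> continuous_maps Q"
  shows "f * g \<in> continuous_maps Q"
proof -
  have "continuous_map Q euclidean (\<lambda>q. (f q, g q))"
    using assms unfolding continuous_maps_def prod_topology_euclidean[symmetric] by (intro continuous_map_pairedI) auto
  moreover have "continuous_map euclidean euclidean (\<lambda>p :: 'i bmat \<times> 'i bmat. fst p * snd p)"
    unfolding continuous_map_iff_continuous2 by (intro continuous_intros)
  ultimately have "continuous_map Q euclidean (\<lambda>q. f q * g q)"
    using continuous_map_compose[of Q euclidean "\<lambda>q. (f q, g q)" euclidean "\<lambda>p. fst p * snd p"]
    by (simp add: o_def)
  then show ?thesis
    using assms by (simp add: continuous_maps_def times_fun_def)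
qed

lemma continuous_maps_scaleC:
  assumes "f \<in> continuous_maps Q"
  shows "scaleC_map c f \<in> continuous_maps Q"
proof -
  have "scaleC_bmat c = (\<lambda>a :: 'b bmat. scaleC_bmat c 1 * a)"
    by (simp add: scaleC_bmat_times fun_eq_iff)
  moreover have "continuous_on UNIV (\<lambda>a :: 'b bmat. scaleC_bmat c 1 * a)"
    by (intro continuous_intros)
  ultimately have "continuous_on UNIV (scaleC_bmat c :: 'b bmat \<Rightarrow> 'b bmat)"
    by metis
  then show ?thesis
    unfolding scaleC_map_def by (rule continuous_maps_compose[OF assms]) simp
qed

text \<open>
  Elements of \<open>continuous_maps Q\<close> vanish outside \<open>topspace Q\<close>, so a constant has to be cut off there.
\<close>

definition constant_map :: "'q topology \<Rightarrow> 'i bmat \<Rightarrow> 'q \<Rightarrow> 'i bmat"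
  where "constant_map Q a = (\<lambda>q. if q \<in> topspace Q then a else 0)"

lemma constant_map_in: "constant_map Q a \<in> continuous_maps Q"
proof -
  have "continuous_map Q euclidean (constant_map Q a)"
    by (rule continuous_map_eq[of _ _ "\<lambda>_. a"]) (simp_all add: constant_map_def)
  then show ?thesis
    by (simp add: continuous_maps_def constant_map_def)
qed

lemma constant_map_simps:
  "constant_map Q (a + b) = constant_map Q a + constant_map Q b"
  "constant_map Q (a * b) = constant_map Q a * constant_map Q b"
  "constant_map Q (scaleC_bmat c a) = scaleC_map c (constant_map Q a)"
  by (simp_all add: constant_map_def scaleC_map_def fun_eq_iff)

text \<open>
  At zero the map is continuous because its norm is \<open>\<surd>\<parallel>a\<parallel>\<close>.
\<close>

lemma continuous_on_inverse_sqrt_norm_scaleR: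
  "continuous_on UNIV (\<lambda>a :: 'a::real_normed_vector. inverse (sqrt (norm a)) *\<^sub>R a)"
proof -
  let ?\<phi> = "\<lambda>a :: 'a. inverse (sqrt (norm a)) *\<^sub>R a"
  have "isCont ?\<phi> a" for a
  proof (cases "a = 0")
    case True
    have "norm (?\<phi> x) = sqrt (norm x)" for x
      by (simp add: real_div_sqrt divide_inverse mult.commute flip: divide_inverse)
    moreover have "((\<lambda>x :: 'a. sqrt (norm x)) \<longlongrightarrow> sqrt (norm (0 :: 'a))) (at 0)"
      by (intro tendsto_intros)
    ultimately have "(?\<phi> \<longlongrightarrow> 0) (at 0)"
      by (intro tendsto_norm_zero_cancel[of ?\<phi>]) simp
    then show ?thesis
      using True by (simp add: isCont_def)
  next
    case False
    then show ?thesis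
      by (intro continuous_intros) auto
  qed
  then show ?thesis
    by (simp add: continuous_at_imp_continuous_on)
qed

text \<open>
  With both factors of \<open>x = h y\<close> vanishing at \<open>q\<close>, so does \<open>D(h) y + h D(y)\<close>.
\<close>

lemma derivation_vanishes:
  fixes D :: "('q \<Rightarrow> 'i bmat) \<Rightarrow> 'q \<Rightarrow> 'i bmat"
  assumes D: "derivation scaleC_map (continuous_maps Q) D"
    and x: "x \<in> continuous_maps Q" and "x q = 0"
  shows "D x q = 0"
proof -
  define h where "h = (\<lambda>p. sqrt (norm (x p)) *\<^sub>R (1 :: 'i bmat))"
  define y where "y = (\<lambda>p. inverse (sqrt (norm (x p))) *\<^sub>R x p)"
  have h: "h \<in> continuous_maps Q"
    unfolding h_def by (rule continuous_maps_compose[OF x]) (auto intro!: continuous_intros)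
  have y: "y \<in> continuous_maps Q"
    unfolding y_def by (rule continuous_maps_compose[OF x continuous_on_inverse_sqrt_norm_scaleR]) simp
  have "x p = h p * y p" for p
    by (cases "x p = 0") (simp_all add: h_def y_def)
  then have "x = h * y"
    by (simp add: fun_eq_iff)
  then have "D x = D h * y + h * D y"
    using D h y by (simp add: derivation_def)
  then show ?thesis
    using \<open>x q = 0\<close> by (simp add: h_def y_def)
qed

lemma derivation_local:
  fixes D :: "('q \<Rightarrow> 'i bmat) \<Rightarrow> 'q \<Rightarrow> 'i bmat"
  assumes D: "derivation scaleC_map (continuous_maps Q) D"
    and x: "x \<in> continuous_maps Q" and y: "y \<in> continuous_maps Q" and eq: "x q = y q"
  shows "D x q = D y q"
proof -
  have diff: "x - y \<in> continuous_maps Q"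
    by (rule continuous_maps_diff[OF x y])
  have "D (x - y + y) = D (x - y) + D y"
    using D diff y unfolding derivation_def by blast
  moreover have "D (x - y) q = 0"
    by (rule derivation_vanishes[OF D diff]) (simp add: eq)
  ultimately show ?thesis
    by simp
qed

lemma derivation_at_point:
  assumes D: "derivation scaleC_map (continuous_maps Q) D"
  shows "derivation scaleC_bmat UNIV (\<lambda>a. D (constant_map Q a) q)"
proof -
  have const: "constant_map Q a \<in> continuous_maps Q" for a :: "'b bmat"
    by (rule constant_map_in)
  have "D (constant_map Q (a * b)) q = D (constant_map Q a) q * b + a * D (constant_map Q b) q" for a b
  proof (cases "q \<in> topspace Q")
    case True
    then show ?thesis
      using D const by (simp add: derivation_def constant_map_simps) (simp add: constant_map_def)
  next
    case False
    have "D (constant_map Q c) \<in> continuous_maps Q" for c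
      using D const by (auto simp: derivation_def)
    then show ?thesis
      using False by (simp add: continuous_maps_def)
  qed
  then show ?thesis
    using D const by (simp add: derivation_def constant_map_simps(1,3)) (simp add: scaleC_map_def)
qed

theorem theorem1:
  fixes Q :: "'q topology"
    and \<Delta> :: "('q \<Rightarrow> 'i bmat) \<Rightarrow> ('q \<Rightarrow> 'i bmat)"
  assumes "compact_space Q"
    and "Hausdorff_space Q"
    and "infinite (UNIV :: 'i set)"
    and "two_local_derivation scaleC_map (continuous_maps Q) \<Delta>"
  shows "derivation scaleC_map (continuous_maps Q) \<Delta>"
proof -
  have maps: "\<Delta> \<in> continuous_maps Q \<rightarrow> continuous_maps Q"
    and agree: "\<And>x y. x \<in> continuous_maps Q \<Longrightarrow> y \<in> continuous_maps Q \<Longrightarrow>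
      \<exists>D. derivation scaleC_map (continuous_maps Q) D \<and> \<Delta> x = D x \<and> \<Delta> y = D y"
    using assms(4) by (auto simp: two_local_derivation_def)
  define \<delta> where "\<delta> q a = \<Delta> (constant_map Q a) q" for q a
  have fibre: "\<Delta> x q = \<delta> q (x q)" if x: "x \<in> continuous_maps Q" and q: "q \<in> topspace Q" for x q
  proof -
    obtain D where D: "derivation scaleC_map (continuous_maps Q) D" "\<Delta> x = D x"
        "\<Delta> (constant_map Q (x q)) = D (constant_map Q (x q))"
      using agree[OF x constant_map_in] by blast
    then show ?thesis
      unfolding \<delta>_def D using x q
      by (intro derivation_local[OF D(1)] constant_map_in) (simp_all add: constant_map_def)
  qed
  have \<delta>: "derivation scaleC_bmat UNIV (\<delta> q)" for q
  proof (rule two_local_derivation_bmat)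
    have "\<exists>D. derivation scaleC_bmat UNIV D \<and> \<delta> q a = D a \<and> \<delta> q b = D b" for a b
    proof -
      obtain D where D: "derivation scaleC_map (continuous_maps Q) D"
          "\<Delta> (constant_map Q a) = D (constant_map Q a)"
          "\<Delta> (constant_map Q b) = D (constant_map Q b)"
        using agree[OF constant_map_in constant_map_in] by blast
      show ?thesis
        by (rule exI[of _ "\<lambda>c. D (constant_map Q c) q"])
           (simp add: \<delta>_def D derivation_at_point)
    qed
    then show "two_local_derivation scaleC_bmat UNIV (\<delta> q)"
      by (simp add: two_local_derivation_def)
  qed
  have outside: "x q = 0" if "x \<in> continuous_maps Q" "q \<notin> topspace Q" for x :: "'q \<Rightarrow> 'i bmat" and q
    using that by (simp add: continuous_maps_def)
  show ?thesis
    unfolding derivation_def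
  proof (intro conjI ballI allI ext maps)
    fix x y :: "'q \<Rightarrow> 'i bmat" and q
    assume x: "x \<in> continuous_maps Q" and y: "y \<in> continuous_maps Q"
    note in_maps = x y continuous_maps_add[OF x y] continuous_maps_times[OF x y]
    show "\<Delta> (x + y) q = (\<Delta> x + \<Delta> y) q"
      using \<delta>[of q] in_maps outside[OF funcset_mem[OF maps]]
      by (cases "q \<in> topspace Q") (simp_all add: fibre derivation_def)
    show "\<Delta> (x * y) q = (\<Delta> x * y + x * \<Delta> y) q"
      using \<delta>[of q] in_maps outside outside[OF funcset_mem[OF maps]]
      by (cases "q \<in> topspace Q") (simp_all add: fibre derivation_def)
  next
    fix c q and x :: "'q \<Rightarrow> 'i bmat"
    assume x: "x \<in> continuous_maps Q"
    show "\<Delta> (scaleC_map c x) q = scaleC_map c (\<Delta> x) q"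
      using \<delta>[of q] x continuous_maps_scaleC[OF x, of c] outside[OF funcset_mem[OF maps]]
      by (cases "q \<in> topspace Q") (simp_all add: fibre derivation_def scaleC_map_def)
  qed
qed

end
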